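(* Let $\Gamma\le\langle(1,2,\dots,n)\rangle$ be a subgroup of the cyclic group generated by the $n$-cycle $(1,2,\dots,n)$, and let $I_0,I_1\subseteq[n]$ be disjoint index sets defining a complete set of fixings for the constraint $x\succeq\gamma(x)$ for each permutation $\gamma\in\Gamma$. Then the set $\mathcal X_\Gamma\cap F(I_0,I_1)$ is non-empty if and only if the sets $\mathcal X_\gamma\cap F(I_0,I_1)$ are non-empty for every permutation $\gamma\in\Gamma$.
   Context: $[n]=\{1,\dots,n\}$. A permutation $\gamma$ of $[n]$ acts on $x\in\mathbb R^n$ by $\gamma(x)=(x_{\gamma^{-1}(1)},\dots,x_{\gamma^{-1}(n)})$. $x\succeq y$ means that $x$ is lexicographically not smaller than $y$. $\mathcal X_\gamma=\{x\in\{0,1\}^n : x\succeq\gamma(x)\}$ and $\mathcal X_\Gamma=\bigcap_{\gamma\in\Gamma}\mathcal X_\gamma$. For disjoint $I_0,I_1\subseteq[n]$, $F(I_0,I_1)=\{x\in\{0,1\}^n : x_i=0 \text{ for } i\in I_0,\ x_i=1\text{ for } i\in I_1\}$. The pair $(I_0,I_1)$ defines a complete set of fixings for the constraint $x\succeq\gamma(x)$ if there is no pair $(i,b)$ with $i\in[n]\setminus(I_0\cup I_1)$ and $b\in\{0,1\}$ such that all $x\in\mathcal X_\gamma\cap F(I_0,I_1)$ satisfy $x_i=b$. *)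

theory Defs
  imports Complex_Main "HOL-Algebra.Sym_Groups"
begin

text \<open>Vectors in \<open>\<real>\<^sup>n\<close> are functions \<open>nat \<Rightarrow> real\<close> that are extensional on \<open>{1..n}\<close>.\<close>

definition binary_vectors :: "nat \<Rightarrow> (nat \<Rightarrow> real) set"
  where "binary_vectors n = {1..n} \<rightarrow>\<^sub>E {0, 1}"

definition perm_act :: "nat \<Rightarrow> (nat \<Rightarrow> nat) \<Rightarrow> (nat \<Rightarrow> real) \<Rightarrow> (nat \<Rightarrow> real)"
  where "perm_act n \<gamma> x = (\<lambda>i\<in>{1..n}. x (Hilbert_Choice.inv \<gamma> i))"

definition lex_ge :: "nat \<Rightarrow> (nat \<Rightarrow> real) \<Rightarrow> (nat \<Rightarrow> real) \<Rightarrow> bool"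
  where "lex_ge n x y \<longleftrightarrow> lexordp_eq (map y [1..<Suc n]) (map x [1..<Suc n])"

definition feasible_perm :: "nat \<Rightarrow> (nat \<Rightarrow> nat) \<Rightarrow> (nat \<Rightarrow> real) set"
  where "feasible_perm n \<gamma> = {x \<in> binary_vectors n. lex_ge n x (perm_act n \<gamma> x)}"

definition feasible_group :: "nat \<Rightarrow> (nat \<Rightarrow> nat) set \<Rightarrow> (nat \<Rightarrow> real) set"
  where "feasible_group n \<Gamma> = (\<Inter>\<gamma>\<in>\<Gamma>. feasible_perm n \<gamma>)"

definition fixing_face :: "nat \<Rightarrow> nat set \<Rightarrow> nat set \<Rightarrow> (nat \<Rightarrow> real) set"
  where "fixing_face n I0 I1 =
    {x \<in> binary_vectors n. (\<forall>i\<in>I0. x i = 0) \<and> (\<forall>i\<in>I1. x i = 1)}"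

text \<open>
  If \<open>feasible_perm n \<gamma> \<inter> fixing_face n I0 I1\<close> is empty, the inner condition holds vacuously, so that
  completeness then forces \<open>I0 \<union> I1\<close> to contain all of \<open>{1..n}\<close>.
\<close>

definition complete_fixings :: "nat \<Rightarrow> (nat \<Rightarrow> nat) \<Rightarrow> nat set \<Rightarrow> nat set \<Rightarrow> bool"
  where "complete_fixings n \<gamma> I0 I1 \<longleftrightarrow>
    \<not> (\<exists>i\<in>{1..n} - (I0 \<union> I1). \<exists>b\<in>{0, 1}.
         \<forall>x\<in>feasible_perm n \<gamma> \<inter> fixing_face n I0 I1. x i = b)"

text \<open>The generator maps \<open>i\<close> to \<open>i + 1\<close> for \<open>i < n\<close>, and \<open>n\<close> to \<open>1\<close>.\<close>

definition cyclic_perms :: "nat \<Rightarrow> (nat \<Rightarrow> nat) set"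
  where "cyclic_perms n = generate (sym_group n) {cycle_of_list [1..<Suc n]}"

end

theory Submission
  imports Defs
begin

text \<open>
  If some entry is free, let \<open>i\<close> be the first one, and let \<open>x\<close> be the point of the face with
  \<open>x\<^sub>i = 1\<close> and all other free entries \<open>0\<close>. Suppose that \<open>x\<close> is smaller than its rotation
  by \<open>p\<close>, with first difference at \<open>t\<close>. By completeness, each \<open>\<gamma> \<in> \<Gamma>\<close> has a feasible point \<open>z\<close>
  of the face with \<open>z\<^sub>i = 1\<close>. It agrees with \<open>x\<close> up to \<open>i\<close> and is pointwise at least \<open>x\<close>, so no rotation
  in \<open>\<Gamma>\<close> can beat \<open>x\<close> first at a position up to \<open>i\<close>. Hence \<open>t > i\<close>, and \<open>x\<close> has period \<open>p\<close> before the
  position \<open>t + p\<close>. If \<open>p\<close> does not exceed \<open>i\<close>, then reducing \<open>t\<close> modulo \<open>p\<close> exhibits a rotation by a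
  multiple of \<open>p\<close> that beats \<open>x\<close> first at a position up to \<open>i\<close>. Otherwise, a feasible point with
  \<open>z\<^sub>i = 0\<close> for the rotation by \<open>p\<close> is beaten at \<open>i\<close>, since the window of length \<open>i\<close> that is rotated
  to the front does not contain \<open>i\<close>. Without free entries the face is a single point.
\<close>

section \<open>Comparing a sequence lexicographically with its shifts\<close>

definition lex_ge_shift :: "nat \<Rightarrow> (nat \<Rightarrow> 'a::linorder) \<Rightarrow> nat \<Rightarrow> bool"
  where "lex_ge_shift n X p \<longleftrightarrow> (\<forall>t<n. (\<forall>s<t. X s = X (s + p)) \<longrightarrow> X (t + p) \<le> X t)"

text \<open>Weak inequalities before \<open>t\<close> suffice: the least position with a strict gain
  is the first difference, and it is at most \<open>t\<close>.\<close>

lemma not_lex_ge_shiftI: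
  assumes "t < n" and "\<And>s. s < t \<Longrightarrow> X s \<le> X (s + p)" and "X t < X (t + p)"
  shows "\<not> lex_ge_shift n X p"
proof -
  define m where "m = (LEAST s. X s < X (s + p))"
  have m: "X m < X (m + p)"
    unfolding m_def by (rule LeastI) (rule assms(3))
  have "m \<le> t"
    unfolding m_def by (rule Least_le) (rule assms(3))
  moreover have "X s = X (s + p)" if "s < m" for s
  proof -
    have "\<not> X s < X (s + p)"
      using not_less_Least that unfolding m_def by blast
    moreover have "X s \<le> X (s + p)"
      using assms(2) that \<open>m \<le> t\<close> by simp
    ultimately show ?thesis by simp
  qed
  ultimately show ?thesis
    using m assms(1) unfolding lex_ge_shift_def by (auto simp: not_le intro!: exI[of _ m])
qed

text \<open>Each step down by \<open>p\<close> from \<open>r + k * p\<close> lands below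
  \<open>t\<close>, where the assumption applies.\<close>

lemma shift_multiple_eq:
  fixes X :: "nat \<Rightarrow> 'a"
  assumes "\<And>s. s < t \<Longrightarrow> X s = X (s + p)" and "r + k * p < t + p"
  shows "X (r + k * p) = X r"
  using assms(2)
proof (induction k)
  case (Suc k)
  then have "X (r + k * p) = X (r + k * p + p)"
    by (intro assms(1)) simp
  moreover have "X (r + k * p) = X r"
    using Suc by simp
  ultimately show ?case
    by (simp add: algebra_simps)
qed simp

text \<open>The combinatorial core, free of permutations: \<open>above\<close> and
  \<open>below\<close> record what completeness provides for the values 1 and 0 at the first free
  position \<open>i\<close>, counted from 0.\<close>

lemma lex_ge_shift_from_bounds:
  fixes X :: "nat \<Rightarrow> 'a::linorder"
  assumes i: "i < n" and p: "0 < p" "p < n"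
    and above: "\<And>q. \<exists>Z. lex_ge_shift n Z (q * p) \<and> (\<forall>s. X s \<le> Z s) \<and> (\<forall>s\<le>i. Z s = X s)"
    and below: "\<exists>Z. lex_ge_shift n Z p \<and> (\<forall>s. s mod n \<noteq> i \<longrightarrow> X s \<le> Z s)
      \<and> (\<forall>s<i. Z s = X s) \<and> Z i < X i"
  shows "lex_ge_shift n X p"
proof (rule ccontr)
  assume "\<not> lex_ge_shift n X p"
  then obtain t where t: "t < n" and eq: "\<And>s. s < t \<Longrightarrow> X s = X (s + p)"
    and less: "X t < X (t + p)"
    unfolding lex_ge_shift_def by (auto simp: not_le)
  \<comment> \<open>The witness \<open>Z\<close> equals \<open>X\<close> up to \<open>s\<close> and
    dominates it everywhere, so it would inherit the gain of \<open>X\<close> at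
    \<open>s\<close>.\<close>
  have no_late_gain: False
    if "s \<le> i" and "\<And>r. r < s \<Longrightarrow> X r = X (r + q * p)" and "X s < X (s + q * p)" for s q
  proof -
    obtain Z where Z: "lex_ge_shift n Z (q * p)" "\<And>s. X s \<le> Z s" "\<And>s. s \<le> i \<Longrightarrow> Z s = X s"
      using above[of q] by auto
    have "\<not> lex_ge_shift n Z (q * p)"
    proof (rule not_lex_ge_shiftI)
      show "s < n" using that(1) i by simp
      show "Z r \<le> Z (r + q * p)" if "r < s" for r
        using Z(2)[of "r + q * p"] Z(3)[of r] that \<open>s \<le> i\<close>
          \<open>\<And>r. r < s \<Longrightarrow> X r = X (r + q * p)\<close>[of r] by simp
      show "Z s < Z (s + q * p)"
        using Z(2)[of "s + q * p"] Z(3)[of s] that(1,3) by simp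
    qed
    with Z(1) show False by simp
  qed
  consider "t \<le> i" | "i < t" "p \<le> i" | "i < t" "i < p" by linarith
  then show False
  proof cases
    case 1
    show ?thesis
    proof (rule no_late_gain)
      show "t \<le> i" by (rule 1)
      show "X r = X (r + 1 * p)" if "r < t" for r
        using eq[OF that] by simp
      show "X t < X (t + 1 * p)"
        using less by simp
    qed
  next
    case 2
    have periodic: "X (r + k * p) = X r" if "r + k * p < t + p" for r k
      using eq that by (rule shift_multiple_eq)
    \<comment> \<open>These give \<open>s + q * p = t + p\<close> with \<open>s < p\<close>.
      Periodicity covers all positions below \<open>t + p\<close>, hence \<open>t\<close> itself,
      but not \<open>t + p\<close>, where the gain occurs.\<close>
    define s where "s = t mod p"
    define q where "q = t div p + 1"
    have ts: "s + (t div p) * p = t" and tp: "t + p = s + q * p"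
      by (simp_all add: s_def q_def algebra_simps)
    have "s < p" using p(1) by (simp add: s_def)
    have "X t = X s"
      using periodic[of s "t div p"] p(1) unfolding ts by simp
    show ?thesis
    proof (rule no_late_gain)
      show "s \<le> i" using \<open>s < p\<close> 2 by simp
      show "X r = X (r + q * p)" if "r < s" for r
        using periodic[of r q] tp that by simp
      show "X s < X (s + q * p)"
        using less \<open>X t = X s\<close> tp by simp
    qed
  next
    case 3
    obtain Z where Z: "lex_ge_shift n Z p" "\<And>s. s mod n \<noteq> i \<Longrightarrow> X s \<le> Z s"
      "\<And>s. s < i \<Longrightarrow> Z s = X s" "Z i < X i"
      using below by auto
    \<comment> \<open>Before wrapping, \<open>s + p\<close> exceeds \<open>i\<close> because
      \<open>p\<close> does; after wrapping, \<open>s + p - n\<close> is below \<open>s\<close> and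
      so below \<open>i\<close>.\<close>
    have avoid: "X (s + p) \<le> Z (s + p)" if "s \<le> i" for s
    proof (rule Z(2))
      show "(s + p) mod n \<noteq> i"
      proof (cases "s + p < n")
        case False
        then have "(s + p) mod n = s + p - n"
          using that i p(2) by (simp add: le_mod_geq)
        then show ?thesis using that p(2) False by linarith
      qed (use 3 in simp)
    qed
    have "\<not> lex_ge_shift n Z p"
    proof (rule not_lex_ge_shiftI)
      show "i < n" by (rule i)
      show "Z s \<le> Z (s + p)" if "s < i" for s
        using Z(3)[of s] eq[of s] avoid[of s] that 3 by simp
      show "Z i < Z (i + p)"
        using Z(4) eq[of i] avoid[of i] 3 by simp
    qed
    with Z(1) show ?thesis by simp
  qed
qed

section \<open>Cyclic permutations as shifts of periodic sequences\<close>

lemma lexordp_eq_iff_first_difference: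
  fixes xs ys :: "'a::linorder list"
  assumes "length ys = length xs"
  shows "lexordp_eq ys xs \<longleftrightarrow>
    (\<forall>t<length xs. (\<forall>s<t. xs ! s = ys ! s) \<longrightarrow> ys ! t \<le> xs ! t)"
  using assms
proof (induction ys xs rule: list_induct2)
  case (Cons y ys x xs)
  have "(\<forall>t<length (x # xs). (\<forall>s<t. (x # xs) ! s = (y # ys) ! s) \<longrightarrow> (y # ys) ! t \<le> (x # xs) ! t)
    \<longleftrightarrow> y \<le> x \<and> (x = y \<longrightarrow> (\<forall>t<length xs. (\<forall>s<t. xs ! s = ys ! s) \<longrightarrow> ys ! t \<le> xs ! t))"
    by (auto simp: All_less_Suc2)
  then show ?case
    unfolding lexordp_eq_simps Cons.IH[symmetric] by auto
qed simp

text \<open>The periodic extension of a vector, with positions counted from 0 instead of 1, so that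
  a rotation becomes a plain addition to the position.\<close>

definition cyclic_ext :: "nat \<Rightarrow> (nat \<Rightarrow> 'a) \<Rightarrow> nat \<Rightarrow> 'a"
  where "cyclic_ext n x t = x (t mod n + 1)"

definition rotates_by :: "nat \<Rightarrow> (nat \<Rightarrow> nat) \<Rightarrow> nat \<Rightarrow> bool"
  where "rotates_by n \<delta> p \<longleftrightarrow> (\<forall>t. \<delta> (t mod n + 1) = (t + p) mod n + 1)"

text \<open>The inverse enters because \<open>perm_act\<close> reads \<open>x\<close> at the
  preimage of each index.\<close>

lemma lex_ge_perm_act_iff:
  assumes "rotates_by n (Hilbert_Choice.inv \<gamma>) p"
  shows "lex_ge n x (perm_act n \<gamma> x) \<longleftrightarrow> lex_ge_shift n (cyclic_ext n x) p"
proof -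
  have nth_x: "map x [1..<Suc n] ! t = cyclic_ext n x t" if "t < n" for t
    using that by (simp add: cyclic_ext_def del: upt_Suc)
  have nth_perm: "map (perm_act n \<gamma> x) [1..<Suc n] ! t = cyclic_ext n x (t + p)" if "t < n" for t
    using that assms[unfolded rotates_by_def, rule_format, of t]
    by (simp add: cyclic_ext_def perm_act_def del: upt_Suc)
  show ?thesis
    unfolding lex_ge_def lex_ge_shift_def
    by (subst lexordp_eq_iff_first_difference)
      (auto simp: nth_x nth_perm simp del: upt_Suc nth_map nth_map_upt One_nat_def)
qed

lemma rotates_by_comp:
  assumes "rotates_by n \<gamma> p" and "rotates_by n \<delta> q"
  shows "rotates_by n (\<gamma> \<circ> \<delta>) (q + p)"
  using assms unfolding rotates_by_def by (simp add: add.assoc)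

lemma rotates_by_cycle:
  assumes "0 < n"
  shows "rotates_by n (cycle_of_list [1..<Suc n]) 1"
  unfolding rotates_by_def
proof
  fix t
  have "map (cycle_of_list [1..<Suc n]) [1..<Suc n] = rotate 1 [1..<Suc n]"
    using cyclic_rotation[of "[1..<Suc n]" 1] by (simp del: upt_Suc)
  then have "map (cycle_of_list [1..<Suc n]) [1..<Suc n] ! (t mod n) = rotate 1 [1..<Suc n] ! (t mod n)"
    by (rule arg_cong)
  then show "cycle_of_list [1..<Suc n] (t mod n + 1) = (t + 1) mod n + 1"
    using assms by (simp add: nth_rotate mod_Suc_eq del: upt_Suc rotate_Suc)
qed

text \<open>Rotating by \<open>n - p\<close> and then by \<open>p\<close> adds \<open>n\<close> to
  the position, which vanishes modulo \<open>n\<close>.\<close>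

lemma rotates_by_inv:
  assumes "\<gamma> permutes {1..n}" and "rotates_by n \<gamma> p" and "p \<le> n"
  shows "rotates_by n (Hilbert_Choice.inv \<gamma>) (n - p)"
  unfolding rotates_by_def
proof
  fix t
  have "\<gamma> ((t + (n - p)) mod n + 1) = t mod n + 1"
    using assms(2,3) unfolding rotates_by_def by simp
  then show "Hilbert_Choice.inv \<gamma> (t mod n + 1) = (t + (n - p)) mod n + 1"
    using permutes_inverses(2)[OF assms(1)] by metis
qed

lemma cyclic_perms_rotates_by:
  assumes "0 < n" and "\<gamma> \<in> cyclic_perms n"
  shows "\<exists>p. rotates_by n \<gamma> p"
  using assms(2) unfolding cyclic_perms_def
proof (induction rule: generate.induct)
  case one
  then show ?case
    by (intro exI[of _ 0]) (simp add: rotates_by_def sym_group_def)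
next
  case (incl h)
  then show ?case using rotates_by_cycle[OF assms(1)] by blast
next
  case (inv h)
  have h: "h permutes {1..n}"
    using inv cycle_permutes[of "[1..<Suc n]"] by (simp add: atLeastLessThanSuc_atLeastAtMost del: upt_Suc)
  then have "inv\<^bsub>sym_group n\<^esub> h = Hilbert_Choice.inv h"
    by (simp add: sym_group_inv_equality sym_group_carrier)
  moreover have "rotates_by n h 1"
    using inv rotates_by_cycle[OF assms(1)] by blast
  then have "rotates_by n (Hilbert_Choice.inv h) (n - 1)"
    using assms(1) by (intro rotates_by_inv[OF h]) simp_all
  ultimately show ?case
    by auto
next
  case (eng h1 h2)
  then show ?case
    unfolding sym_group_mult using rotates_by_comp by blast
qed

theorem proposition3p2:
  fixes n :: nat and \<Gamma> :: "(nat \<Rightarrow> nat) set" and I0 I1 :: "nat set"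
  assumes "subgroup \<Gamma> (sym_group n)"
    and "\<Gamma> \<subseteq> cyclic_perms n"
    and "I0 \<subseteq> {1..n}" and "I1 \<subseteq> {1..n}" and "I0 \<inter> I1 = {}"
    and "\<And>\<gamma>. \<gamma> \<in> \<Gamma> \<Longrightarrow> complete_fixings n \<gamma> I0 I1"
  shows "feasible_group n \<Gamma> \<inter> fixing_face n I0 I1 \<noteq> {} \<longleftrightarrow>
    (\<forall>\<gamma>\<in>\<Gamma>. feasible_perm n \<gamma> \<inter> fixing_face n I0 I1 \<noteq> {})"
proof
  assume "feasible_group n \<Gamma> \<inter> fixing_face n I0 I1 \<noteq> {}"
  then show "\<forall>\<gamma>\<in>\<Gamma>. feasible_perm n \<gamma> \<inter> fixing_face n I0 I1 \<noteq> {}"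
    unfolding feasible_group_def by blast
next
  assume nonempty: "\<forall>\<gamma>\<in>\<Gamma>. feasible_perm n \<gamma> \<inter> fixing_face n I0 I1 \<noteq> {}"
  have "id \<in> \<Gamma>"
    using subgroup.one_closed[OF assms(1)] by (simp add: sym_group_one)
  show "feasible_group n \<Gamma> \<inter> fixing_face n I0 I1 \<noteq> {}"
  proof (cases "{1..n} \<subseteq> I0 \<union> I1")
    case True
    \<comment> \<open>The hypothesis for the identity supplies a point of the face.\<close>
    obtain x where x: "x \<in> fixing_face n I0 I1"
      using nonempty \<open>id \<in> \<Gamma>\<close> by blast
    have unique: "y = x" if "y \<in> fixing_face n I0 I1" for y
    proof (rule PiE_ext)
      show "y \<in> {1..n} \<rightarrow>\<^sub>E {0, 1}" "x \<in> {1..n} \<rightarrow>\<^sub>E {0, 1}"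
        using that x by (auto simp: fixing_face_def binary_vectors_def)
      show "y k = x k" if "k \<in> {1..n}" for k
        using that True x \<open>y \<in> fixing_face n I0 I1\<close> unfolding fixing_face_def by fastforce
    qed
    have "x \<in> feasible_perm n \<gamma>" if "\<gamma> \<in> \<Gamma>" for \<gamma>
      using nonempty that unique by blast
    then show ?thesis
      using x unfolding feasible_group_def by blast
  next
    case False
    define f where "f = (LEAST k. k \<in> {1..n} - (I0 \<union> I1))"
    have f: "f \<in> {1..n} - (I0 \<union> I1)"
      unfolding f_def by (rule LeastI_ex) (use False in blast)
    have fixed: "k \<in> I0 \<union> I1" if "1 \<le> k" "k < f" for k
      using not_less_Least[of k "\<lambda>k. k \<in> {1..n} - (I0 \<union> I1)"] that f
      unfolding f_def[symmetric] by auto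
    define i where "i = f - 1"
    have i: "f = i + 1" "i < n" using f by (auto simp: i_def)
    have "0 < n" using i by simp
    define x where "x = (\<lambda>k\<in>{1..n}. if k \<in> I1 \<or> k = f then 1 else 0 :: real)"
    have x_binary: "x \<in> binary_vectors n"
      by (auto simp: x_def binary_vectors_def)
    have x_face: "x \<in> fixing_face n I0 I1"
      using x_binary f assms(3-5) by (auto simp: fixing_face_def x_def)
    let ?X = "cyclic_ext n"
    have index: "t mod n + 1 \<in> {1..n}" for t
      using \<open>0 < n\<close> by (simp add: Suc_le_eq)
    \<comment> \<open>Away from \<open>f\<close>, the point \<open>x\<close> is 1 only on
      \<open>I1\<close>, where every point of the face is 1.\<close>
    have face_ge: "?X x t \<le> ?X z t"
      if "z \<in> fixing_face n I0 I1" "t mod n \<noteq> i \<or> z f = 1" for z t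
    proof -
      have "z (t mod n + 1) \<in> {0, 1}"
        using that(1) index[of t] by (auto simp: fixing_face_def binary_vectors_def PiE_iff)
      then show ?thesis
        using that index[of t] i(1) by (auto simp: cyclic_ext_def x_def fixing_face_def)
    qed
    have face_eq: "?X z t = ?X x t" if "z \<in> fixing_face n I0 I1" "t < i" for z t
      using that x_face fixed[of "t + 1"] i by (auto simp: cyclic_ext_def fixing_face_def)
    have X_i: "?X z i = z f" for z :: "nat \<Rightarrow> real"
      using i by (simp add: cyclic_ext_def)
    have x_f: "x f = 1"
      using f by (simp add: x_def)
    \<comment> \<open>Completeness prevents \<open>f\<close> from being fixed to
      \<open>1 - b\<close>; entries are binary, so some feasible point takes the value
      \<open>b\<close> there.\<close>
    have witness: "\<exists>z \<in> feasible_perm n \<gamma> \<inter> fixing_face n I0 I1. z f = b"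
      if \<gamma>: "\<gamma> \<in> \<Gamma>" and b: "b \<in> {0, 1}" for \<gamma> b
    proof -
      have "1 - b \<in> {0, 1}"
        using b by auto
      then obtain z where z: "z \<in> feasible_perm n \<gamma> \<inter> fixing_face n I0 I1" "z f \<noteq> 1 - b"
        using assms(6)[OF \<gamma>] f unfolding complete_fixings_def by blast
      have "z f \<in> {0, 1}"
        using z(1) f unfolding fixing_face_def binary_vectors_def by blast
      then have "z f = b" using z(2) b by auto
      then show ?thesis using z(1) by blast
    qed
    have inv_closed: "Hilbert_Choice.inv \<gamma> \<in> \<Gamma>" "\<gamma> permutes {1..n}" if "\<gamma> \<in> \<Gamma>" for \<gamma>
      using subgroup.m_inv_closed[OF assms(1) that] subgroup.mem_carrier[OF assms(1) that]
      by (simp_all add: sym_group_carrier)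
    have "x \<in> feasible_perm n \<gamma>" if \<gamma>: "\<gamma> \<in> \<Gamma>" for \<gamma>
    proof -
      define \<delta> where "\<delta> = Hilbert_Choice.inv \<gamma>"
      have "\<delta> \<in> \<Gamma>" using inv_closed \<gamma> by (simp add: \<delta>_def)
      then obtain p' where "rotates_by n \<delta> p'"
        using cyclic_perms_rotates_by[OF \<open>0 < n\<close>] assms(2) by blast
      define p where "p = p' mod n"
      have p: "rotates_by n \<delta> p"
        using \<open>rotates_by n \<delta> p'\<close> by (simp add: rotates_by_def p_def mod_add_right_eq)
      have lex_iff: "lex_ge n y (perm_act n \<gamma> y) \<longleftrightarrow> lex_ge_shift n (?X y) p" for y
        using p unfolding \<delta>_def by (rule lex_ge_perm_act_iff)
      \<comment> \<open>Powers of \<open>\<delta>\<close> stay in the subgroup and rotate by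
        multiples of \<open>p\<close>; the inverse of such a power serves as
        \<open>\<gamma>'\<close>.\<close>
      have multiple: "\<exists>\<gamma>'\<in>\<Gamma>. rotates_by n (Hilbert_Choice.inv \<gamma>') (q * p)" for q
      proof -
        have pow: "\<delta> ^^ q \<in> \<Gamma> \<and> rotates_by n (\<delta> ^^ q) (q * p)"
        proof (induction q)
          case 0
          then show ?case using \<open>id \<in> \<Gamma>\<close> by (simp add: rotates_by_def id_def)
        next
          case (Suc q)
          then show ?case
            using subgroup.m_closed[OF assms(1) \<open>\<delta> \<in> \<Gamma>\<close>, of "\<delta> ^^ q"]
              rotates_by_comp[OF p, of "\<delta> ^^ q" "q * p"]
            by (simp only: sym_group_mult funpow.simps mult_Suc add.commute simp_thms)
        qed
        then have "Hilbert_Choice.inv (Hilbert_Choice.inv (\<delta> ^^ q)) = \<delta> ^^ q"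
          using inv_inv_eq[OF permutes_bij[OF inv_closed(2)]] by simp
        then have "rotates_by n (Hilbert_Choice.inv (Hilbert_Choice.inv (\<delta> ^^ q))) (q * p)"
          using pow by simp
        then show ?thesis
          using pow inv_closed(1) by blast
      qed
      have "lex_ge_shift n (?X x) p"
      proof (cases "p = 0")
        case True
        then show ?thesis by (simp add: lex_ge_shift_def)
      next
        case False
        show ?thesis
        proof (rule lex_ge_shift_from_bounds)
          show "i < n" "0 < p" "p < n"
            using i False \<open>0 < n\<close> by (auto simp: p_def)
          show "\<exists>Z. lex_ge_shift n Z (q * p) \<and> (\<forall>s. ?X x s \<le> Z s) \<and> (\<forall>s\<le>i. Z s = ?X x s)" for q
          proof -
            obtain \<gamma>' where \<gamma>': "\<gamma>' \<in> \<Gamma>" "rotates_by n (Hilbert_Choice.inv \<gamma>') (q * p)"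
              using multiple by blast
            obtain z where z: "z \<in> feasible_perm n \<gamma>'" "z \<in> fixing_face n I0 I1" "z f = 1"
              using witness[OF \<gamma>'(1), of 1] by auto
            have "lex_ge_shift n (?X z) (q * p)"
              using z(1) lex_ge_perm_act_iff[OF \<gamma>'(2)] by (simp add: feasible_perm_def)
            moreover have "?X z s = ?X x s" if "s \<le> i" for s
              using that face_eq[OF z(2)] X_i x_f z(3) by (cases "s = i") auto
            ultimately show ?thesis
              using face_ge[OF z(2)] z(3) by blast
          qed
          obtain z where z: "z \<in> feasible_perm n \<gamma>" "z \<in> fixing_face n I0 I1" "z f = 0"
            using witness[OF \<gamma>, of 0] by auto
          have "lex_ge_shift n (?X z) p"
            using z(1) lex_iff by (simp add: feasible_perm_def)
          moreover have "?X z i < ?X x i"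
            using X_i x_f z(3) by simp
          ultimately show "\<exists>Z. lex_ge_shift n Z p \<and> (\<forall>s. s mod n \<noteq> i \<longrightarrow> ?X x s \<le> Z s)
              \<and> (\<forall>s<i. Z s = ?X x s) \<and> Z i < ?X x i"
            using face_ge[OF z(2)] face_eq[OF z(2)] by blast
        qed
      qed
      then show ?thesis
        using lex_iff x_binary by (simp add: feasible_perm_def)
    qed
    then show ?thesis
      using x_face unfolding feasible_group_def by blast
  qed
qed

end
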